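(* Let $n$ be an integer with $n \geq 11$. If $n \equiv 2,5,8 \pmod{11}$, then $\lceil 4n/11 \rceil \leq \gamma^{ID}(C_n(1,3)) \leq \lceil 4n/11 \rceil + 1$; otherwise $\gamma^{ID}(C_n(1,3)) = \lceil 4n/11 \rceil$.
   Context: For a positive integer $n$, the circulant graph $C_n(1,3)$ has vertex set $\mathbb{Z}_n=\{0,1,\dots,n-1\}$, and the open neighbourhood of $u$ is $N(u)=\{u\pm 1, u\pm 3\}$ (computed modulo $n$); the closed neighbourhood is $N[u]=N(u)\cup\{u\}$. A code is a nonempty subset $C\subseteq \mathbb{Z}_n$; for a vertex $u$, its identifying set is $I(C;u)=N[u]\cap C$. The code $C$ is identifying if $I(C;u)\neq\emptyset$ for all vertices $u$ and $I(C;u)\neq I(C;v)$ for all distinct vertices $u,v$. $\gamma^{ID}(G)$ denotes the minimum cardinality of an identifying code in $G$. *)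

theory Defs
  imports Complex_Main
begin

text \<open>
  A graph is given by its vertex set \<open>V\<close> and its open neighbourhood function \<open>N\<close>.
\<close>

definition closed_nbhd :: "('a \<Rightarrow> 'a set) \<Rightarrow> 'a \<Rightarrow> 'a set" where
  "closed_nbhd N u = N u \<union> {u}"

definition identifying_set :: "('a \<Rightarrow> 'a set) \<Rightarrow> 'a set \<Rightarrow> 'a \<Rightarrow> 'a set" where
  "identifying_set N C u = closed_nbhd N u \<inter> C"

definition code :: "'a set \<Rightarrow> 'a set \<Rightarrow> bool" where
  "code V C \<longleftrightarrow> C \<subseteq> V \<and> C \<noteq> {}"

definition identifying_code :: "'a set \<Rightarrow> ('a \<Rightarrow> 'a set) \<Rightarrow> 'a set \<Rightarrow> bool" where
  "identifying_code V N C \<longleftrightarrow> code V C \<and>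
     (\<forall>u\<in>V. identifying_set N C u \<noteq> {}) \<and>
     (\<forall>u\<in>V. \<forall>v\<in>V. u \<noteq> v \<longrightarrow> identifying_set N C u \<noteq> identifying_set N C v)"

text \<open>
  The minimum is over a set that is finite when \<open>V\<close> is; it is unspecified if the graph
  admits no identifying code.
\<close>

definition gamma_ID :: "'a set \<Rightarrow> ('a \<Rightarrow> 'a set) \<Rightarrow> nat" where
  "gamma_ID V N = Min (card ` {C. identifying_code V N C})"

text \<open>
  The circulant graph \<open>C\<^sub>n(1,3)\<close>. Residues modulo \<open>n\<close> are represented by the integers
  \<open>0, \<dots>, n - 1\<close>, so that subtraction is not truncated and \<open>mod\<close> yields
  the representative.
\<close>

definition circ13_verts :: "nat \<Rightarrow> int set" where
  "circ13_verts n = {0..<int n}"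

definition circ13_nbhd :: "nat \<Rightarrow> int \<Rightarrow> int set" where
  "circ13_nbhd n u =
     {(u + 1) mod int n, (u - 1) mod int n, (u + 3) mod int n, (u - 3) mod int n}"

end

theory Submission
  imports Defs
begin

text \<open>
  Unroll a set of residues to an \<open>n\<close>-periodic bit sequence \<open>x\<close> on the integers. Being identifying is
  then a condition on the windows of length 13 of \<open>x\<close>, because vertices more than 6 apart have
  disjoint closed neighbourhoods.

  For the lower bound, covering and the separation of vertices at distance 1, 2 and 4 suffice.
  There is a potential \<open>\<phi>\<close> on windows of length 10 such that each admissible shift of the window
  satisfies \<open>\<phi>(new) - \<phi>(old) \<le> 11 b - 4\<close>, where \<open>b\<close> is the bit that enters; summing over a
  period gives \<open>11 |C| \<ge> 4 n\<close>.

  For the upper bound, inserting the 11-bit word \<open>01100110000\<close> of weight 4 next to a copy of itself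
  creates no new windows, which reduces the construction to one word per residue class modulo 11.
\<close>

section \<open>Neighbourhoods lifted to the integers\<close>

definition offsets :: "int set" where
  "offsets = {-3, -1, 0, 1, 3}"

text \<open>Keeping \<open>t\<close> unreduced turns adjacency into the linear condition
  \<open>t - u \<in> offsets\<close>, so all wrap-around is confined to the final image modulo
  \<open>n\<close>.\<close>

lemma identifying_set_mod:
  assumes "n > 0"
  shows "identifying_set (circ13_nbhd n) C (u mod int n) =
    (\<lambda>t. t mod int n) ` {t. t mod int n \<in> C \<and> t - u \<in> offsets}"
proof -
  have "closed_nbhd (circ13_nbhd n) (u mod int n) = (\<lambda>k. (u + k) mod int n) ` offsets"
    by (auto simp: closed_nbhd_def circ13_nbhd_def offsets_def mod_simps)
  also have "\<dots> = (\<lambda>t. t mod int n) ` {t. t - u \<in> offsets}"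
  proof -
    have "{t. t - u \<in> offsets} = (\<lambda>k. u + k) ` offsets"
      by (auto simp: image_iff) (metis add.commute diff_add_cancel)
    then show ?thesis
      by (simp add: image_image)
  qed
  finally show ?thesis
    by (auto simp: identifying_set_def)
qed

lemma card_nat_int: "card {i. i < n \<and> P (int i)} = card {t \<in> {0..<int n}. P t}"
proof -
  have "{t \<in> {0..<int n}. P t} = int ` {i. i < n \<and> P (int i)}"
    by (auto simp: image_iff) (metis nat_0_le zless_nat_eq_int_zless nat_int nat_less_iff)
  then show ?thesis
    by (simp add: card_image)
qed

subsection \<open>The lower bound\<close>

datatype decision_tree = L int | N decision_tree decision_tree

text \<open>Windows with a common prefix and equal potential share a leaf, hence \<open>L\<close>
  ignores the remaining bits. The value 0 is a default for lists that end before a leaf.\<close>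

fun lookup :: "decision_tree \<Rightarrow> bool list \<Rightarrow> int" where
  "lookup (N l r) (b # bs) = lookup (if b then r else l) bs"
| "lookup (L v) bs = v"
| "lookup (N l r) [] = 0"

text \<open>
  Found by computer: shortest-path potentials in the graph whose vertices are the windows of
  length 10 and whose edges are the windows of length 11 that satisfy the local constraints, an
  edge having length \<open>11 b - 4\<close> for its newest bit \<open>b\<close>. Windows are listed from the newest bit to
  the oldest.
\<close>

definition potential :: "bool list \<Rightarrow> int" where
  "potential = lookup
    (N (N (N (N (N (N (L 0) (N (L 0) (N (L 0) (L 4)))) (N (L 0) (N (L 4) (L 8)))) (N (N
     (N (L 3) (N (L 3) (L 4))) (L 4)) (N (L 8) (N (N (N (N (L 9) (L 12)) (L 12)) (L 12))
     (L 12))))) (N (N (N (N (L 6) (L 8)) (N (L 7) (L 8))) (L 8)) (N (N (N (N (N (L 6) (L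
     9)) (L 9)) (L 12)) (L 12)) (N (N (N (N (L 13) (L 16)) (L 16)) (L 16)) (L 16))))) (N
     (N (N (N (N (L 0) (N (L 3) (L 10))) (N (L 0) (N (L 9) (L 12)))) (N (L 11) (L 12)))
     (N (N (N (N (L 6) (L 12)) (L 12)) (N (N (L 9) (L 12)) (L 12))) (L 12))) (N (N (N (N
     (N (L 10) (L 13)) (L 13)) (L 16)) (L 16)) (N (N (N (N (L 17) (L 20)) (L 20)) (L 20))
     (L 20))))) (N (N (N (N (N (L 7) (N (L 7) (N (L 10) (L 14)))) (N (L 10) (N (L 13) (L
     16)))) (N (N (N (N (L 13) (L 15)) (N (L 13) (L 15))) (L 15)) (N (N (N (N (N (L 13)
     (L 16)) (L 16)) (L 16)) (L 16)) (L 16)))) (N (N (N (N (L 10) (L 16)) (L 16)) (N (N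
     (L 13) (L 16)) (L 16))) (L 16))) (N (N (N (N (N (L 14) (N (L 14) (L 17))) (L 17)) (L
     20)) (N (N (N (N (L 17) (L 20)) (L 20)) (L 20)) (L 20))) (N (N (N (N (L 21) (L 24))
     (L 24)) (L 24)) (L 24)))))"

text \<open>A finite check over the 11-bit windows, \<open>a0\<close> being the newest bit. The
  premises are all translates that fit: five for covering, then four, three and one for separation
  at distances 1, 2 and 4.\<close>

lemma potential_step:
  "\<forall>a0 a1 a2 a3 a4 a5 a6 a7 a8 a9 a10.
      (a0 \<or> a2 \<or> a3 \<or> a4 \<or> a6) \<and>
      (a1 \<or> a3 \<or> a4 \<or> a5 \<or> a7) \<and>
      (a2 \<or> a4 \<or> a5 \<or> a6 \<or> a8) \<and>
      (a3 \<or> a5 \<or> a6 \<or> a7 \<or> a9) \<and>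
      (a4 \<or> a6 \<or> a7 \<or> a8 \<or> a10) \<and>
      (a0 \<or> a1 \<or> a2 \<or> a5 \<or> a6 \<or> a7) \<and>
      (a1 \<or> a2 \<or> a3 \<or> a6 \<or> a7 \<or> a8) \<and>
      (a2 \<or> a3 \<or> a4 \<or> a7 \<or> a8 \<or> a9) \<and>
      (a3 \<or> a4 \<or> a5 \<or> a8 \<or> a9 \<or> a10) \<and>
      (a0 \<or> a3 \<or> a5 \<or> a8) \<and>
      (a1 \<or> a4 \<or> a6 \<or> a9) \<and>
      (a2 \<or> a5 \<or> a7 \<or> a10) \<and>
      (a0 \<or> a2 \<or> a3 \<or> a7 \<or> a8 \<or> a10) \<longrightarrow>
      potential [a0,a1,a2,a3,a4,a5,a6,a7,a8,a9] - potential [a1,a2,a3,a4,a5,a6,a7,a8,a9,a10]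
        \<le> 11 * of_bool a0 - 4"
  by code_simp

lemma card_lower_bound:
  assumes n: "n \<ge> 11" and C: "identifying_code (circ13_verts n) (circ13_nbhd n) C"
  shows "4 * int n \<le> 11 * int (card C)"
proof -
  define x where "x t \<longleftrightarrow> t mod int n \<in> C" for t
  have CV: "C \<subseteq> {0..<int n}"
    using C by (auto simp: identifying_code_def code_def circ13_verts_def)
  have vert: "t mod int n \<in> circ13_verts n" for t
    using n by (simp add: circ13_verts_def)
  have idset: "identifying_set (circ13_nbhd n) C (u mod int n) =
      (\<lambda>t. t mod int n) ` {t. x t \<and> t - u \<in> offsets}" for u
    using n by (simp add: identifying_set_mod x_def)
  have "identifying_set (circ13_nbhd n) C (u mod int n) \<noteq> {}" for u
    using C vert by (simp add: identifying_code_def)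
  then have ex: "\<exists>t. x t \<and> t - u \<in> offsets" for u
    unfolding idset by blast
  \<comment> \<open>Here and below the vertices are shifted so that \<open>z\<close> is the newest
    bit involved.\<close>
  have cover: "x z \<or> x (z - 2) \<or> x (z - 3) \<or> x (z - 4) \<or> x (z - 6)" for z
  proof -
    obtain t where t: "x t" "t - (z - 3) \<in> offsets"
      using ex by blast
    then have "t \<in> {z, z - 2, z - 3, z - 4, z - 6}"
      by (auto simp: offsets_def)
    then show ?thesis
      using t by auto
  qed
  \<comment> \<open>Equal preimages would have equal images modulo \<open>n\<close>, so wrap-around
    does no harm in this direction.\<close>
  have sep: "\<exists>t. x t \<and> (t - u \<in> offsets) \<noteq> (t - (u + d) \<in> offsets)"
    if d: "0 < d" "d < int n" for u d
  proof -
    have "u mod int n \<noteq> (u + d) mod int n"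
    proof
      assume "u mod int n = (u + d) mod int n"
      then have "int n dvd (u + d) - u"
        by (metis mod_eq_dvd_iff)
      then show False
        using d zdvd_imp_le by fastforce
    qed
    then have "identifying_set (circ13_nbhd n) C (u mod int n) \<noteq>
        identifying_set (circ13_nbhd n) C ((u + d) mod int n)"
      using C vert by (simp add: identifying_code_def)
    then show ?thesis
      unfolding idset by blast
  qed
  have sep1: "x z \<or> x (z - 1) \<or> x (z - 2) \<or> x (z - 5) \<or> x (z - 6) \<or> x (z - 7)" for z
  proof -
    obtain t where t: "x t" "(t - (z - 4) \<in> offsets) \<noteq> (t - (z - 4 + 1) \<in> offsets)"
      using sep[of 1] n by fastforce
    then have "t \<in> {z, z - 1, z - 2, z - 5, z - 6, z - 7}"
      by (auto simp: offsets_def)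
    then show ?thesis
      using t by auto
  qed
  have sep2: "x z \<or> x (z - 3) \<or> x (z - 5) \<or> x (z - 8)" for z
  proof -
    obtain t where t: "x t" "(t - (z - 5) \<in> offsets) \<noteq> (t - (z - 5 + 2) \<in> offsets)"
      using sep[of 2] n by fastforce
    then have "t \<in> {z, z - 3, z - 5, z - 8}"
      by (auto simp: offsets_def)
    then show ?thesis
      using t by auto
  qed
  have sep4: "x z \<or> x (z - 2) \<or> x (z - 3) \<or> x (z - 7) \<or> x (z - 8) \<or> x (z - 10)" for z
  proof -
    obtain t where t: "x t" "(t - (z - 7) \<in> offsets) \<noteq> (t - (z - 7 + 4) \<in> offsets)"
      using sep[of 4] n by fastforce
    then have "t \<in> {z, z - 2, z - 3, z - 7, z - 8, z - 10}"
      by (auto simp: offsets_def)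
    then show ?thesis
      using t by auto
  qed
  define \<phi> where "\<phi> i = potential (map (\<lambda>k. x (i - 1 - k)) [0..9])" for i :: int
  have step: "\<phi> (i + 1) - \<phi> i \<le> 11 * of_bool (x i) - 4" for i
  proof -
    have "\<phi> (i + 1) = potential [x i, x (i - 1), x (i - 2), x (i - 3), x (i - 4), x (i - 5),
        x (i - 6), x (i - 7), x (i - 8), x (i - 9)]"
      by (simp add: \<phi>_def upto.simps)
    moreover have "\<phi> i = potential [x (i - 1), x (i - 2), x (i - 3), x (i - 4), x (i - 5),
        x (i - 6), x (i - 7), x (i - 8), x (i - 9), x (i - 10)]"
      by (simp add: \<phi>_def upto.simps)
    ultimately show ?thesis
      \<comment> \<open>The arguments follow the first occurrences of the variables in the premises:
        \<open>a0 a2 a3 a4 a6 a1 a5 a7 a8 a9 a10\<close>.\<close>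
      using potential_step[rule_format, of "x i" "x (i - 2)" "x (i - 3)" "x (i - 4)" "x (i - 6)"
          "x (i - 1)" "x (i - 5)" "x (i - 7)" "x (i - 8)" "x (i - 9)" "x (i - 10)"]
        cover[of i] cover[of "i - 1"] cover[of "i - 2"] cover[of "i - 3"] cover[of "i - 4"]
        sep1[of i] sep1[of "i - 1"] sep1[of "i - 2"] sep1[of "i - 3"]
        sep2[of i] sep2[of "i - 1"] sep2[of "i - 2"] sep4[of i]
      by simp
  qed
  \<comment> \<open>Periodicity closes the walk of windows, so the potential differences over one
    period cancel.\<close>
  have "x (int n - 1 - k) = x (0 - 1 - k)" for k
    using mod_add_self1[of "int n" "- 1 - k"] by (simp add: x_def algebra_simps)
  then have "\<phi> (int n) = \<phi> 0"
    by (simp only: \<phi>_def)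
  then have "0 = (\<Sum>i<n. \<phi> (int (Suc i)) - \<phi> (int i))"
    by (subst sum_lessThan_telescope) simp
  also have "\<dots> \<le> (\<Sum>i<n. 11 * of_bool (x (int i)) - 4)"
    by (intro sum_mono) (use step in \<open>simp only: of_nat_Suc add.commute[of 1]\<close>)
  also have "\<dots> = 11 * int (card {i. i < n \<and> int i \<in> C}) - 4 * int n"
    by (simp add: sum_subtractf x_def sum.If_cases of_bool_def flip: sum_distrib_left)
       (simp add: lessThan_def Int_def)
  also have "card {i. i < n \<and> int i \<in> C} = card {t \<in> {0..<int n}. t \<in> C}"
    by (rule card_nat_int)
  also have "{t \<in> {0..<int n}. t \<in> C} = C"
    using CV by blast
  finally show ?thesis
    by simp
qed

subsection \<open>The upper bound\<close>

text \<open>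
  The bits that can tell apart the window positions \<open>3\<close> and \<open>3 + d\<close>, for \<open>d = 1, \<dots>, 6\<close>; the first
  entry is the closed neighbourhood of position \<open>3\<close>.
\<close>

definition constraints :: "nat list list" where
  "constraints = [[0, 2, 3, 4, 6], [0, 1, 2, 5, 6, 7], [0, 3, 5, 8], [0, 2, 4, 5, 7, 9],
     [0, 2, 3, 7, 8, 10], [0, 2, 3, 4, 5, 6, 7, 8, 9, 11], [0, 2, 3, 4, 8, 9, 10, 12]]"

lemma constraints_separate:
  "\<forall>d\<in>{1, 2, 3, 4, 5, 6}. \<exists>D\<in>set constraints. \<forall>j\<in>set D.
     (int j - 3 \<in> offsets) \<noteq> (int j - 3 - d \<in> offsets)"
  by code_simp

text \<open>Suffixes of fewer than 13 bits hold no full window and pass. Recursion on the list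
  permits evaluation, also when only a prefix is known.\<close>

fun admissible :: "bool list \<Rightarrow> bool" where
  "admissible [] \<longleftrightarrow> True"
| "admissible (b # w) \<longleftrightarrow>
     (length w < 12 \<or> (\<forall>D\<in>set constraints. \<exists>j\<in>set D. (b # w) ! j)) \<and> admissible w"

lemma admissible_nth:
  "admissible w \<Longrightarrow> i + 12 < length w \<Longrightarrow> D \<in> set constraints \<Longrightarrow> \<exists>j\<in>set D. w ! (i + j)"
proof (induction w arbitrary: i)
  case (Cons b w)
  show ?case
  proof (cases i)
    case 0
    then show ?thesis
      using Cons.prems by auto
  next
    case (Suc k)
    then show ?thesis
      using Cons.IH[of k] Cons.prems by simp
  qed
qed simp

text \<open>Repeating the first 12 bits makes every cyclic window of length 13 a factor of a
  list.\<close>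

definition cyclically_admissible :: "bool list \<Rightarrow> bool" where
  "cyclically_admissible w \<longleftrightarrow> length w \<ge> 13 \<and> admissible (w @ take 12 w)"

text \<open>Vertices at cyclic distance at most 6 are separated by a window constraint; all others
  have disjoint nonempty identifying sets.\<close>

lemma identifying_code_of_word:
  assumes w: "cyclically_admissible w"
  defines "n \<equiv> length w"
  defines "C \<equiv> {t \<in> {0..<int n}. w ! nat t}"
  shows "identifying_code (circ13_verts n) (circ13_nbhd n) C"
proof -
  have n: "n \<ge> 13"
    using w by (simp add: n_def cyclically_admissible_def)
  define x where "x t \<longleftrightarrow> t mod int n \<in> C" for t
  have x_iff: "x t \<longleftrightarrow> w ! nat (t mod int n)" for t
    using n by (simp add: x_def C_def)
  have constr: "\<exists>j\<in>set D. x (z + int j)" if D: "D \<in> set constraints" for D z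
  proof -
    define i where "i = nat (z mod int n)"
    have i: "i < n" "int i = z mod int n"
      using n by (auto simp: i_def nat_less_iff)
    have "i + 12 < length (w @ take 12 w)"
      using i n by (simp add: n_def)
    then obtain j where j: "j \<in> set D" "(w @ take 12 w) ! (i + j)"
      using admissible_nth D w unfolding cyclically_admissible_def by blast
    have "j \<le> 12"
      using j(1) D by (auto simp: constraints_def)
    have "nat ((z + int j) mod int n) = (i + j) mod n"
      by (metis i(2) mod_add_left_eq nat_int of_nat_add of_nat_mod)
    moreover have "(w @ take 12 w) ! (i + j) = w ! ((i + j) mod n)"
    proof (cases "i + j < n")
      case True
      then show ?thesis
        by (simp add: nth_append n_def)
    next
      case False
      then have "(i + j) mod n = i + j - n"
        using i \<open>j \<le> 12\<close> n by (simp add: mod_if)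
      moreover have "i + j - n < 12"
        using i \<open>j \<le> 12\<close> False by linarith
      ultimately show ?thesis
        using False by (simp add: nth_append n_def)
    qed
    ultimately have "x (z + int j)"
      using j(2) by (simp only: x_iff)
    then show ?thesis
      using j(1) by blast
  qed
  define I where "I u = identifying_set (circ13_nbhd n) C (u mod int n)" for u
  have I_eq: "I u = (\<lambda>t. t mod int n) ` {t. x t \<and> t - u \<in> offsets}" for u
    using n by (simp add: I_def identifying_set_mod x_def)
  have I_ne: "I u \<noteq> {}" for u
  proof -
    have "[0, 2, 3, 4, 6] \<in> set constraints"
      by (simp add: constraints_def)
    from constr[OF this, of "u - 3"] have "\<exists>t. x t \<and> t - u \<in> offsets"
      by (auto simp: offsets_def)
    then show ?thesis
      by (auto simp: I_eq)
  qed
  have near: "I u \<noteq> I (u + d)" if d: "1 \<le> d" "d \<le> 6" for u d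
  proof -
    have "d \<in> {1, 2, 3, 4, 5, 6}"
      using d by auto
    then obtain D where D: "D \<in> set constraints"
      "\<And>j. j \<in> set D \<Longrightarrow> (int j - 3 \<in> offsets) \<noteq> (int j - 3 - d \<in> offsets)"
      using constraints_separate by blast
    obtain j where j: "j \<in> set D" "x (u - 3 + int j)"
      using constr[OF D(1)] by blast
    define t where "t = u - 3 + int j"
    have t: "x t" "(t - u \<in> offsets) \<noteq> (t - (u + d) \<in> offsets)"
      using D(2)[OF j(1)] j(2) by (auto simp: t_def algebra_simps)
    \<comment> \<open>The two lifts differ by at most 3 + 6 + 3 = 12, which is less than
      \<open>n\<close>; a separating bit thus survives reduction.\<close>
    have close: "t = t'" if "t mod int n = t' mod int n" "t - v \<in> offsets" "t' - v' \<in> offsets"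
      "\<bar>v - v'\<bar> \<le> 6" for t t' v v'
    proof (rule ccontr)
      assume "t \<noteq> t'"
      moreover have "int n dvd t - t'"
        using that(1) by (simp add: mod_eq_dvd_iff)
      ultimately have "int n \<le> \<bar>t - t'\<bar>"
        using dvd_imp_le_int[of "t - t'" "int n"] by simp
      moreover have "\<bar>t - v\<bar> \<le> 3" "\<bar>t' - v'\<bar> \<le> 3"
        using that(2,3) by (auto simp: offsets_def)
      ultimately show False
        using n that(4) by linarith
    qed
    show ?thesis
    proof (cases "t - u \<in> offsets")
      case True
      then have "t mod int n \<in> I u"
        using t by (auto simp: I_eq)
      moreover have "t mod int n \<notin> I (u + d)"
        using close[of t _ u "u + d"] t True d by (auto simp: I_eq)
      ultimately show ?thesis
        by blast
    next
      case False
      then have "t mod int n \<in> I (u + d)"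
        using t by (auto simp: I_eq)
      moreover have "t mod int n \<notin> I u"
        using close[of t _ "u + d" u] t False d by (auto simp: I_eq)
      ultimately show ?thesis
        by blast
    qed
  qed
  have distinct: "I u \<noteq> I v" if uv: "0 \<le> u" "u < v" "v < int n" for u v
  proof -
    \<comment> \<open>In the last case neighbourhoods of radius 3 leave a gap on both sides of the
      cycle.\<close>
    consider "v - u \<le> 6" | "u + int n - v \<le> 6" | "7 \<le> v - u" "v - u \<le> int n - 7"
      by linarith
    then show ?thesis
    proof cases
      case 1
      then show ?thesis
        using near[of "v - u" u] uv by simp
    next
      case 2
      have "I (u + int n) = I u"
        by (simp add: I_def)
      then show ?thesis
        using near[of "u + int n - v" v] 2 uv by simp
    next
      case 3
      have "I u \<inter> I v = {}"
      proof -
        have False if "t - u \<in> offsets" "t' - v \<in> offsets" "t mod int n = t' mod int n" for t t'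
        proof -
          have "\<bar>t - u\<bar> \<le> 3" "\<bar>t' - v\<bar> \<le> 3"
            using that by (auto simp: offsets_def)
          then have "0 < t' - t" "t' - t < int n"
            using 3 by linarith+
          moreover have "int n dvd t' - t"
            using that(3) by (metis mod_eq_dvd_iff)
          ultimately show False
            using zdvd_imp_le by fastforce
        qed
        then show ?thesis
          by (auto simp: I_eq)
      qed
      then show ?thesis
        using I_ne[of u] by auto
    qed
  qed
  have mod_id: "u mod int n = u" if "u \<in> circ13_verts n" for u
    using that by (simp add: circ13_verts_def)
  have "C \<subseteq> circ13_verts n"
    by (auto simp: C_def circ13_verts_def)
  moreover have "C \<noteq> {}"
    using I_ne[of 0] by (auto simp: I_def identifying_set_def)
  moreover have "identifying_set (circ13_nbhd n) C u \<noteq> {}" if "u \<in> circ13_verts n" for u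
    using I_ne[of u] mod_id[OF that] by (simp add: I_def)
  moreover have "identifying_set (circ13_nbhd n) C u \<noteq> identifying_set (circ13_nbhd n) C v"
    if "u \<in> circ13_verts n" "v \<in> circ13_verts n" "u \<noteq> v" for u v
  proof -
    have "I u \<noteq> I v"
      using that distinct[of u v] distinct[of v u]
      by (cases "u < v") (auto simp: circ13_verts_def)
    then show ?thesis
      using that by (simp add: I_def mod_id)
  qed
  ultimately show ?thesis
    by (auto simp: identifying_code_def code_def)
qed

section \<open>Words of every length\<close>

lemma card_code_of_word:
  "card {t \<in> {0..<int (length w)}. w ! nat t} = length (filter id w)"
  using card_nat_int[of "length w" "\<lambda>t. w ! nat t"] by (simp add: length_filter_conv_card)

abbreviation pattern :: "bool list" where
  "pattern \<equiv> [False,True,True,False,False,True,True,False,False,False,False]"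

text \<open>The quotient is the ceiling of 4n/11; the exceptional residues allow one more
  vertex.\<close>

definition target :: "nat \<Rightarrow> nat" where
  "target n = (4 * n + 10) div 11 + (if n mod 11 \<in> {2, 5, 8} then 1 else 0)"

definition good_word :: "nat \<Rightarrow> bool list \<Rightarrow> bool" where
  "good_word n w \<longleftrightarrow> cyclically_admissible w \<and> length w = n \<and> length (filter id w) = target n"

text \<open>
  A word that starts with 12 bits of the periodic continuation of the pattern keeps exactly the
  same windows when another copy of the pattern is inserted in front.
\<close>

lemma good_word_extend:
  assumes "good_word n w" and pre: "take 12 w = pattern @ [False]"
  shows "good_word (n + 11) (pattern @ w)" "take 12 (pattern @ w) = pattern @ [False]"
proof -
  obtain v where v: "w = pattern @ False # v"
    using pre by (metis append.assoc append_Cons append_Nil append_take_drop_id)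
  have "target (n + 11) = target n + 4"
    by (simp add: target_def)
  \<comment> \<open>The 11 windows starting in the new copy lie within
    \<open>pattern @ pattern @ [False]\<close>, so their bits are known and simp evaluates the
    constraints.\<close>
  then show "good_word (n + 11) (pattern @ w)"
    using assms(1) by (simp add: v good_word_def cyclically_admissible_def constraints_def)
  show "take 12 (pattern @ w) = pattern @ [False]"
    by (simp add: v)
qed

text \<open>One word per length from 14 to 24, hence one per residue class modulo 11.\<close>

definition base_words :: "bool list list" where
  "base_words = [
    [False, True, True, False, False, True, True, False, False, False, False, False, True,
      True],
    [False, True, True, False, False, True, True, False, False, False, False, False, True,
      True, False],
    [False, True, True, False, False, True, True, False, False, False, False, False, True,
      True, True, False],
    [False, True, True, False, False, True, True, False, False, False, False, False, True,
      True, False, True, False],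
    [False, True, True, False, False, True, True, False, False, False, False, False, True,
      True, False, True, False, False],
    [False, True, True, False, False, True, True, False, False, False, False, False, True,
      True, False, False, True, True, False],
    [False, True, True, False, False, True, True, False, False, False, False, False, True,
      True, False, True, True, False, False, False],
    [False, True, True, False, False, True, True, False, False, False, False, False, True,
      True, False, False, True, True, False, False, False],
    [False, True, True, False, False, True, True, False, False, False, False, False, True,
      True, False, False, True, True, False, False, False, False],
    [False, True, True, False, False, True, True, False, False, False, False, False, True,
      True, False, False, True, True, True, False, False, False, False],
    [False, True, True, False, False, True, True, False, False, False, False, False, True,
      True, False, False, True, True, False, False, False, False, True, True]]"

lemma base_words_good:
  "\<forall>w\<in>set base_words. good_word (length w) w \<and> take 12 w = pattern @ [False]"
  by code_simp

lemma good_word_exists: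
  assumes "n \<ge> 14"
  shows "\<exists>w. good_word n w \<and> take 12 w = pattern @ [False]"
  using assms
proof (induction n rule: less_induct)
  case (less n)
  show ?case
  proof (cases "n \<le> 24")
    case True
    have "length ` set base_words = {14..24}"
      by code_simp
    then obtain w where "w \<in> set base_words" "length w = n"
      using True less.prems by (metis atLeastAtMost_iff imageE)
    then show ?thesis
      using base_words_good by blast
  next
    case False
    then have "n - 11 < n" "14 \<le> n - 11"
      by linarith+
    then obtain w where "good_word (n - 11) w" "take 12 w = pattern @ [False]"
      using less.IH by blast
    then show ?thesis
      using good_word_extend[of "n - 11" w] False by auto
  qed
qed

text \<open>Lengths 11 and 12 are below the window length 13, so the definition is checked directly.
  This code is the set of ones of \<open>pattern\<close>.\<close>

lemma small_code_11: "identifying_code (circ13_verts 11) (circ13_nbhd 11) {1, 2, 5, 6}"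
  by code_simp

lemma small_code_12: "identifying_code (circ13_verts 12) (circ13_nbhd 12) {0, 1, 2, 5, 6}"
  by code_simp

lemma good_word_13:
  "good_word 13 [True,True,False,False,True,True,False,False,False,False,False,True,True]"
  by code_simp

lemma code_exists:
  assumes "n \<ge> 11"
  shows "\<exists>C. identifying_code (circ13_verts n) (circ13_nbhd n) C \<and> card C = target n"
proof -
  have from_word: "\<exists>C. identifying_code (circ13_verts n) (circ13_nbhd n) C \<and> card C = target n"
    if "good_word n w" for w
    using that identifying_code_of_word[of w] card_code_of_word[of w]
    by (auto simp: good_word_def)
  consider "n = 11" | "n = 12" | "n = 13" | "n \<ge> 14"
    using assms by linarith
  then show ?thesis
  proof cases
    case 1
    show ?thesis
      unfolding 1 by (intro exI conjI, rule small_code_11) (simp add: target_def)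
  next
    case 2
    show ?thesis
      unfolding 2 by (intro exI conjI, rule small_code_12) (simp add: target_def)
  next
    case 3
    then show ?thesis
      using from_word good_word_13 by blast
  next
    case 4
    then show ?thesis
      using from_word good_word_exists by blast
  qed
qed

section \<open>Both bounds applied to the minimum\<close>

theorem theorem1:
  fixes n :: nat
  assumes "n \<ge> 11"
  shows "if n mod 11 \<in> {2, 5, 8}
         then \<lceil>4 * real n / 11\<rceil> \<le> int (gamma_ID (circ13_verts n) (circ13_nbhd n)) \<and>
              int (gamma_ID (circ13_verts n) (circ13_nbhd n)) \<le> \<lceil>4 * real n / 11\<rceil> + 1
         else int (gamma_ID (circ13_verts n) (circ13_nbhd n)) = \<lceil>4 * real n / 11\<rceil>"
proof -
  let ?\<C> = "{C. identifying_code (circ13_verts n) (circ13_nbhd n) C}"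
  let ?\<gamma> = "gamma_ID (circ13_verts n) (circ13_nbhd n)"
  have "?\<C> \<subseteq> Pow (circ13_verts n)"
    by (auto simp: identifying_code_def code_def)
  then have fin: "finite (card ` ?\<C>)"
    by (simp add: circ13_verts_def finite_subset)
  obtain C where C: "C \<in> ?\<C>" "card C = target n"
    using code_exists[OF assms] by blast
  \<comment> \<open>Since a code exists, the minimum is attained and the lower bound applies to a
    minimizer.\<close>
  have "?\<gamma> \<in> card ` ?\<C>"
    unfolding gamma_ID_def using fin C by (intro Min_in) auto
  then have "4 * int n \<le> 11 * int ?\<gamma>"
    using card_lower_bound[OF assms] by auto
  then have lower: "\<lceil>4 * real n / 11\<rceil> \<le> int ?\<gamma>"
    by (simp add: ceiling_le_iff)
  have "?\<gamma> \<le> target n"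
    unfolding gamma_ID_def using fin C by (metis Min_le imageI)
  moreover have "int ((4 * n + 10) div 11) \<le> \<lceil>4 * real n / 11\<rceil>"
  proof -
    have "11 * ((4 * n + 10) div 11) < 4 * n + 11"
      by linarith
    then show ?thesis
      by (simp add: le_ceiling_iff)
  qed
  ultimately show ?thesis
    using lower by (auto simp: target_def)
qed

end
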